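(* Let $M\in\mathcal{I}_1$ be bounded, with $M\neq\{1,2\}$ and $3\notin M$. Then $\max M\ge7$.
   Context: For a summable sequence $\mathbf{x}=(x_n)$ of positive reals, $\mathcal{A}(\mathbf{x})=\{\sum_{n\in A}x_n: A\subseteq\mathbb{N}\}$ is its achievement set and its cardinal function $f$ assigns to $x\in\mathcal{A}(\mathbf{x})$ the cardinality (a positive integer, $\omega$, or $\mathfrak{c}$) of $\{(\varepsilon_n)\in\{0,1\}^{\mathbb{N}}:\sum\varepsilon_nx_n=x\}$. $\mathcal{I}_1$ is the family of ranges of cardinal functions of such sequences whose achievement set is a single closed interval. A set $M\subseteq\{1,2,\dots\}\cup\{\omega,\mathfrak{c}\}$ is bounded if there is $N\in\mathbb{N}$ with $M\subseteq\{1,\dots,N\}$. *)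

theory Defs
  imports "HOL-Analysis.Analysis"
begin

datatype cardval = Fin nat | Omega | Cont

definition achievement_set :: "(nat \<Rightarrow> real) \<Rightarrow> real set" where
  "achievement_set x = {(\<Sum>n. if n \<in> A then x n else 0) | A. A \<subseteq> (UNIV :: nat set)}"

definition reps :: "(nat \<Rightarrow> real) \<Rightarrow> real \<Rightarrow> (nat \<Rightarrow> bool) set" where
  "reps x t = {e. (\<Sum>n. if e n then x n else 0) = t}"

text \<open>Cardinality of a set of 0-1 sequences (uncountable sets of representations are
  closed subsets of the Cantor space, hence of cardinality continuum).\<close>
definition cardval_of :: "'a set \<Rightarrow> cardval" where
  "cardval_of S = (if finite S then Fin (card S) else if countable S then Omega else Cont)"

definition cardinal_function :: "(nat \<Rightarrow> real) \<Rightarrow> real \<Rightarrow> cardval" where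
  "cardinal_function x t = cardval_of (reps x t)"

definition I1 :: "cardval set set" where
  "I1 = {cardinal_function x ` achievement_set x | x.
          (\<forall>n. x n > 0) \<and> summable x \<and> (\<exists>a b. achievement_set x = {a..b})}"

definition bounded_cv :: "cardval set \<Rightarrow> bool" where
  "bounded_cv M \<longleftrightarrow> (\<exists>N. M \<subseteq> Fin ` {1..N})"

end

theory Submission
  imports Defs
begin

text \<open>
  Arrange the sequence in decreasing order; as the achievement set is an interval, every term is at
  most the sum of the later ones (Kakeya). If the inequality is strict infinitely often, then
  overlapping cylinders can be split again and again inside any interval, so the numbers of
  representations are unbounded. Hence from some index on every term equals its tail, i.e. the
  sequence ends in a geometric series of ratio 1/2, for which dyadic interior points have two
  representations and all other points one.

  If this holds from the first index, the range is \<open>{1, 2}\<close>. Otherwise let \<open>a\<close> be the last term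
  below its tail \<open>L\<close>, and let it occur \<open>k\<close> times. Since \<open>L / 2 \<le> a < L\<close>, the number of
  representations of \<open>t\<close> slightly above \<open>a\<close> is \<open>c(t) + k c(t - a)\<close>, where \<open>c\<close> counts representations
  by the geometric tail. For \<open>k = 1\<close> or \<open>k = 2\<close> a suitable \<open>t\<close> gives the value 3, and for \<open>k \<ge> 3\<close>
  making \<open>t - a\<close> dyadic (relative to \<open>L\<close>) gives at least \<open>1 + 2 k \<ge> 7\<close>.
\<close>

section \<open>Unordered subset sums and the decreasing rearrangement\<close>

lemma suminf_if_eq_infsum:
  fixes x :: "nat \<Rightarrow> real"
  assumes "\<And>n. x n > 0" "summable x"
  shows "(\<Sum>n. if n \<in> A then x n else 0) = infsum x A"
proof -
  let ?y = "\<lambda>n. if n \<in> A then x n else 0"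
  have "summable ?y"
    by (rule summable_comparison_test'[OF assms(2), of 0]) (use assms(1) less_imp_le in auto)
  then have "?y summable_on UNIV"
    using assms by (intro summable_nonneg_imp_summable_on) (auto simp: less_imp_le)
  then have "(?y has_sum infsum ?y UNIV) UNIV"
    by simp
  then have "?y sums infsum ?y UNIV"
    by (rule has_sum_imp_sums)
  moreover have "infsum ?y UNIV = infsum x A"
    by (rule infsum_cong_neutral) auto
  ultimately show ?thesis
    by (simp add: sums_iff)
qed

lemma cardval_of_bij_betw:
  assumes "bij_betw g S T"
  shows "cardval_of S = cardval_of T"
proof -
  have "countable S \<longleftrightarrow> countable T"
    using assms by (metis bij_betw_def countable_image_inj_eq)
  then show ?thesis
    using assms by (simp add: cardval_of_def bij_betw_finite bij_betw_same_card)
qed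

text \<open>Positive terms tending to 0 leave only finitely many indices in \<open>P n\<close>,
  those to be listed before \<open>n\<close> (larger term, ties by smaller index). Counting them is
  a bijection, and its inverse is the required order.\<close>

lemma decreasing_rearrangement:
  fixes x :: "nat \<Rightarrow> real"
  assumes pos: "\<And>n. x n > 0" and lim: "x \<longlonglongrightarrow> 0"
  obtains \<pi> :: "nat \<Rightarrow> nat" where "bij \<pi>" "decseq (x \<circ> \<pi>)"
proof -
  define P where "P n = {k. x k > x n \<or> (x k = x n \<and> k < n)}" for n
  define rank where "rank n = card (P n)" for n
  have fin: "finite (P n)" for n
  proof -
    have "eventually (\<lambda>k. x k < x n) sequentially"
      using lim pos by (rule order_tendstoD)
    then have "finite {k. \<not> x k < x n}"
      by (simp flip: cofinite_eq_sequentially add: eventually_cofinite)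
    moreover have "P n \<subseteq> {k. \<not> x k < x n}"
      by (auto simp: P_def)
    ultimately show ?thesis
      by (rule rev_finite_subset)
  qed
  have less: "rank k < rank n" if "k \<in> P n" for k n
  proof -
    have "P k \<subset> P n"
      using that by (force simp: P_def)
    then show ?thesis
      unfolding rank_def using fin psubset_card_mono by blast
  qed
  have tot: "k \<in> P n \<or> n \<in> P k" if "k \<noteq> n" for k n
    using that by (force simp: P_def)
  have inj: "inj rank"
    using less tot by (metis injI less_irrefl)
  have "surj rank"
  proof -
    have "\<exists>n. rank n = j" for j
    proof -
      have "infinite (range rank)"
        using inj finite_imageD by blast
      then obtain n where n: "j < rank n"
        by (metis finite_nat_iff_bounded_le not_le rangeE subsetI atMost_iff)
      \<comment> \<open>\<open>rank\<close> maps \<open>P n\<close> injectively into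
        \<open>{..<rank n}\<close>, which has equally many elements, so every number below an
        attained rank is attained.\<close>
      have "rank ` P n = {..<rank n}"
      proof (rule card_subset_eq)
        show "rank ` P n \<subseteq> {..<rank n}"
          using less by auto
        show "card (rank ` P n) = card {..<rank n}"
          using card_image[OF inj_on_subset[OF inj subset_UNIV], of "P n"] by (simp add: rank_def)
      qed auto
      then show ?thesis
        using n by (metis imageE lessThan_iff)
    qed
    then show ?thesis
      by (metis surjI)
  qed
  with inj have bij: "bij rank"
    by (simp add: bij_def)
  show ?thesis
  proof
    show "bij (inv rank)"
      using bij by (rule bij_imp_bij_inv)
    show "decseq (x \<circ> inv rank)"
    proof (rule decseq_SucI, rule ccontr)
      fix i
      assume "\<not> (x \<circ> inv rank) (Suc i) \<le> (x \<circ> inv rank) i"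
      then have "inv rank (Suc i) \<in> P (inv rank i)"
        by (simp add: P_def)
      then have "rank (inv rank (Suc i)) < rank (inv rank i)"
        by (rule less)
      then show False
        using \<open>surj rank\<close> by (simp add: surj_f_inv_f)
    qed
  qed
qed

section \<open>Subset sums and tails of a positive series\<close>

locale pos_series =
  fixes x :: "nat \<Rightarrow> real"
  assumes pos: "x n > 0"
    and summable_UNIV: "x summable_on UNIV"
begin

definition tail :: "nat \<Rightarrow> real" where
  "tail n = infsum x {n..}"

lemma summable_any: "x summable_on A"
  using summable_UNIV by (rule summable_on_subset_banach) simp

lemma infsum_ge_0: "infsum x A \<ge> 0"
  using pos by (simp add: infsum_nonneg less_imp_le)

lemma infsum_Un: "A \<inter> B = {} \<Longrightarrow> infsum x (A \<union> B) = infsum x A + infsum x B"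
  by (intro infsum_Un_disjoint summable_any)

lemma infsum_subset_le:
  assumes "A \<subseteq> B"
  shows "infsum x A \<le> infsum x B"
  using infsum_Un[of A "B - A"] infsum_ge_0[of "B - A"] assms by (simp add: Un_absorb1)

lemma infsum_ge_member:
  assumes "n \<in> A"
  shows "x n \<le> infsum x A"
  using infsum_subset_le[of "{n}" A] assms by simp

text \<open>A missing index costs a positive term. Hence the extreme sums, 0 and a full tail, have
  exactly one representation.\<close>

lemma infsum_eq_subset:
  assumes "A \<subseteq> B" "infsum x A = infsum x B"
  shows "A = B"
proof (rule ccontr)
  assume "A \<noteq> B"
  then obtain n where n: "n \<in> B - A"
    using assms(1) by blast
  have "infsum x B = infsum x A + infsum x (B - A)"
    using infsum_Un[of A "B - A"] assms(1) by (simp add: Un_absorb1)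
  moreover have "x n \<le> infsum x (B - A)"
    using n by (rule infsum_ge_member)
  ultimately show False
    using assms(2) pos[of n] by simp
qed

lemma infsum_eq_0: "infsum x A = 0 \<longleftrightarrow> A = {}"
  using infsum_eq_subset[of "{}" A] by auto

lemma infsum_split: "infsum x A = sum x (A \<inter> {..<n}) + infsum x (A \<inter> {n..})"
proof -
  have "infsum x A = infsum x ((A \<inter> {..<n}) \<union> (A \<inter> {n..}))"
    by (rule arg_cong[where f = "infsum x"]) auto
  also have "\<dots> = infsum x (A \<inter> {..<n}) + infsum x (A \<inter> {n..})"
    by (rule infsum_Un) auto
  finally show ?thesis
    by simp
qed

lemma tail_Suc: "tail n = x n + tail (Suc n)"
proof -
  have "{n..} = {n} \<union> {Suc n..}"
    by auto
  then show ?thesis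
    using infsum_Un[of "{n}" "{Suc n..}"] by (simp add: tail_def)
qed

lemma tail_pos: "tail n > 0"
  using infsum_ge_member[of n "{n..}"] pos[of n] by (simp add: tail_def)

lemma tail_0: "tail 0 = infsum x UNIV"
  by (simp add: tail_def)

lemma infsum_le_tail: "A \<subseteq> {n..} \<Longrightarrow> infsum x A \<le> tail n"
  unfolding tail_def by (rule infsum_subset_le)

lemma tail_tendsto_0: "tail \<longlonglongrightarrow> 0"
proof -
  have "x sums infsum x UNIV"
    using summable_UNIV by (intro has_sum_imp_sums) simp
  then have "(\<lambda>n. sum x {..<n}) \<longlonglongrightarrow> infsum x UNIV"
    by (simp add: sums_def)
  then have "(\<lambda>n. infsum x UNIV - sum x {..<n}) \<longlonglongrightarrow> infsum x UNIV - infsum x UNIV"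
    by (intro tendsto_intros)
  moreover have "infsum x UNIV - sum x {..<n} = tail n" for n
    using infsum_split[of UNIV n] by (simp add: tail_def)
  ultimately show ?thesis
    by simp
qed

text \<open>Sufficient half of Kakeya's theorem: go through the indices from \<open>n\<close> on and
  take a term whenever it fits into the remainder \<open>\<rho>\<close>. The remainder never exceeds
  the current tail, and tails tend to 0.\<close>

lemma greedy_representation:
  assumes fill: "\<And>k. k \<ge> n \<Longrightarrow> x k \<le> tail (Suc k)"
    and t: "0 \<le> t" "t \<le> tail n"
  obtains A where "A \<subseteq> {n..}" "infsum x A = t"
proof -
  define \<rho> where "\<rho> = rec_nat t (\<lambda>j \<rho>. if x (n + j) \<le> \<rho> then \<rho> - x (n + j) else \<rho>)"
  have \<rho>_0: "\<rho> 0 = t"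
    and \<rho>_Suc: "\<rho> (Suc j) = (if x (n + j) \<le> \<rho> j then \<rho> j - x (n + j) else \<rho> j)" for j
    by (simp_all add: \<rho>_def)
  define A where "A = {n + j | j. x (n + j) \<le> \<rho> j}"
  \<comment> \<open>If the term fits, \<open>tail_Suc\<close> bounds the new remainder; if not, the
    remainder is below the term, which \<open>fill\<close> bounds by the next tail.\<close>
  have bounds: "0 \<le> \<rho> j \<and> \<rho> j \<le> tail (n + j)" for j
  proof (induction j)
    case 0
    then show ?case
      using t by (simp add: \<rho>_0)
  next
    case (Suc j)
    then show ?case
      using fill[of "n + j"] tail_Suc[of "n + j"] by (auto simp: \<rho>_Suc)
  qed
  have partial: "sum x (A \<inter> {..<n + j}) = t - \<rho> j" for j
  proof (induction j)
    case 0
    have "A \<inter> {..<n} = {}"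
      by (auto simp: A_def)
    then show ?case
      by (simp add: \<rho>_0)
  next
    case (Suc j)
    have "A \<inter> {..<n + Suc j} = (if x (n + j) \<le> \<rho> j then insert (n + j) (A \<inter> {..<n + j})
        else A \<inter> {..<n + j})"
      by (auto simp: A_def less_Suc_eq)
    then show ?case
      using Suc by (simp add: \<rho>_Suc)
  qed
  have "\<bar>infsum x A - t\<bar> \<le> tail (n + j)" for j
  proof -
    have "infsum x A = t - \<rho> j + infsum x (A \<inter> {n + j..})"
      using infsum_split[of A "n + j"] partial by simp
    moreover have "infsum x (A \<inter> {n + j..}) \<le> tail (n + j)"
      by (rule infsum_le_tail) simp
    ultimately show ?thesis
      using bounds[of j] infsum_ge_0[of "A \<inter> {n + j..}"] by linarith
  qed
  moreover have "(\<lambda>j. tail (n + j)) \<longlonglongrightarrow> 0"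
    using LIMSEQ_ignore_initial_segment[OF tail_tendsto_0, of n] by (simp add: add.commute)
  ultimately have "\<bar>infsum x A - t\<bar> \<le> 0"
    by (meson LIMSEQ_le_const)
  moreover have "A \<subseteq> {n..}"
    by (auto simp: A_def)
  ultimately show ?thesis
    using that by simp
qed

text \<open>Induction on \<open>k\<close>. Fix a prefix and a late index \<open>m\<close> with
  slack: the sums that use \<open>m\<close> and those that omit it fill overlapping intervals. On
  part of the overlap the induction hypothesis gives \<open>k\<close> representations with
  \<open>m\<close>, and the greedy one without \<open>m\<close> is new.\<close>

lemma many_representations:
  assumes fill: "\<And>k. x k \<le> tail (Suc k)"
    and slack: "\<And>n. \<exists>k\<ge>n. x k < tail (Suc k)"
    and uv: "0 \<le> u" "u < v" "v \<le> tail n"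
  obtains u' v' where "u \<le> u'" "u' < v'" "v' \<le> v"
    "\<And>t. \<lbrakk>u' < t; t < v'\<rbrakk> \<Longrightarrow> \<exists>E. finite E \<and> card E = k \<and> (\<forall>A\<in>E. A \<subseteq> {n..} \<and> infsum x A = t)"
  using uv
proof (induction k arbitrary: n u v thesis)
  case 0
  show ?case
    by (rule "0.prems"(1)[of u v]) (use "0.prems" in \<open>auto intro: exI[of _ "{}"]\<close>)
next
  case (Suc k)
  \<comment> \<open>The midpoint is the target: once \<open>tail m\<close> is less than half the
    length, every continuation of the part of \<open>B\<close> below \<open>m\<close> stays between
    \<open>u\<close> and \<open>v\<close>.\<close>
  obtain B where B: "B \<subseteq> {n..}" "infsum x B = (u + v) / 2"
    by (rule greedy_representation[of n "(u + v) / 2"]) (use fill Suc.prems in auto)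
  have "eventually (\<lambda>m. tail m < (v - u) / 2) sequentially"
    using Suc.prems by (intro order_tendstoD[OF tail_tendsto_0]) simp
  then obtain m0 where m0: "\<And>m. m \<ge> m0 \<Longrightarrow> tail m < (v - u) / 2"
    by (auto simp: eventually_sequentially)
  obtain m where m: "m \<ge> max m0 n" "x m < tail (Suc m)"
    using slack by blast
  define s where "s = sum x (B \<inter> {..<m})"
  have s: "(u + v) / 2 = s + infsum x (B \<inter> {m..})"
    using infsum_split[of B m] B by (simp add: s_def)
  have s_le: "s \<le> (u + v) / 2" "(u + v) / 2 \<le> s + tail m"
    using infsum_ge_0[of "B \<inter> {m..}"] infsum_le_tail[of "B \<inter> {m..}" m] s by simp_all
  have small: "tail m < (v - u) / 2"
    using m m0 by simp
  \<comment> \<open>The interval from 0 to \<open>tail (Suc m) - x m\<close> is the overlap moved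
    down by \<open>s + x m\<close>; the slack at \<open>m\<close> makes it nondegenerate.\<close>
  obtain u' v' where uv': "0 \<le> u'" "u' < v'" "v' \<le> tail (Suc m) - x m"
    and E: "\<And>t. \<lbrakk>u' < t; t < v'\<rbrakk> \<Longrightarrow>
      \<exists>E. finite E \<and> card E = k \<and> (\<forall>A\<in>E. A \<subseteq> {Suc m..} \<and> infsum x A = t)"
    by (rule Suc.IH[of 0 "tail (Suc m) - x m" "Suc m"]) (use m pos[of m] in auto)
  have extend: "infsum x ((B \<inter> {..<m}) \<union> C) = s + infsum x C" if "C \<subseteq> {m..}" for C
    using infsum_Un[of "B \<inter> {..<m}" C] that by (force simp: s_def)
  show ?case
  proof (rule Suc.prems(1)[of "s + x m + u'" "s + x m + v'"])
    show "u \<le> s + x m + u'" "s + x m + v' \<le> v" "s + x m + u' < s + x m + v'"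
      using s_le small uv' pos[of m] tail_Suc[of m] by auto
  next
    fix t
    assume t: "s + x m + u' < t" "t < s + x m + v'"
    obtain E' where E': "finite E'" "card E' = k" "\<And>A. A \<in> E' \<Longrightarrow> A \<subseteq> {Suc m..}"
      "\<And>A. A \<in> E' \<Longrightarrow> infsum x A = t - s - x m"
      using E[of "t - s - x m"] t by auto
    \<comment> \<open>The additional representation omits \<open>m\<close>; \<open>t - s\<close> is
      still within reach of the later terms because
      \<open>v' \<le> tail (Suc m) - x m\<close>.\<close>
    obtain C where C: "C \<subseteq> {Suc m..}" "infsum x C = t - s"
      by (rule greedy_representation[of "Suc m" "t - s"])
        (use fill t uv' pos[of m] in \<open>auto intro: order.trans\<close>)
    define h where "h A = (B \<inter> {..<m}) \<union> insert m A" for A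
    have hm: "infsum x (insert m A) = x m + infsum x A" if "A \<subseteq> {Suc m..}" for A
      using infsum_Un[of "{m}" A] that by force
    have inj: "inj_on h E'"
    proof (rule inj_onI)
      fix A A'
      assume "A \<in> E'" "A' \<in> E'" "h A = h A'"
      moreover have "A = h A \<inter> {Suc m..}" if "A \<in> E'" for A
        using E'(3)[OF that] by (auto simp: h_def)
      ultimately show "A = A'"
        by metis
    qed
    have notin: "(B \<inter> {..<m}) \<union> C \<notin> h ` E'"
      using C by (force simp: h_def)
    show "\<exists>E. finite E \<and> card E = Suc k \<and> (\<forall>A\<in>E. A \<subseteq> {n..} \<and> infsum x A = t)"
    proof (intro exI conjI ballI)
      let ?E = "insert ((B \<inter> {..<m}) \<union> C) (h ` E')"
      show "finite ?E" "card ?E = Suc k"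
        using E' notin inj by (auto simp: card_image)
      fix A
      assume A: "A \<in> ?E"
      show "A \<subseteq> {n..}"
        using A B(1) C(1) E'(3) m(1) by (force simp: h_def)
      have "infsum x (h A') = t" if "A' \<in> E'" for A'
      proof -
        have "insert m A' \<subseteq> {m..}"
          using E'(3)[OF that] by force
        then show ?thesis
          using extend[of "insert m A'"] hm[of A'] E'(3,4)[OF that] by (simp add: h_def)
      qed
      moreover have "infsum x ((B \<inter> {..<m}) \<union> C) = t"
      proof -
        have "C \<subseteq> {m..}"
          using C(1) by force
        then show ?thesis
          using extend[of C] C(2) by simp
      qed
      ultimately show "infsum x A = t"
        using A by blast
    qed
  qed
qed

end

section \<open>Dyadic rationals\<close>

definition dyadic_reals :: "real set" where
  "dyadic_reals = {of_int j / 2 ^ q | j q. True}"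

lemma dyadic_reals_of_int [simp]: "of_int j \<in> dyadic_reals"
  unfolding dyadic_reals_def by (rule CollectI, rule exI[of _ j], rule exI[of _ 0]) simp

lemma dyadic_reals_half_power [simp]: "1 / 2 ^ q \<in> dyadic_reals"
  unfolding dyadic_reals_def by (rule CollectI, rule exI[of _ 1], rule exI[of _ q]) simp

lemma dyadic_reals_add:
  assumes "a \<in> dyadic_reals" "b \<in> dyadic_reals"
  shows "a + b \<in> dyadic_reals"
proof -
  obtain i p j q where "a = of_int i / 2 ^ p" "b = of_int j / 2 ^ q"
    using assms by (auto simp: dyadic_reals_def)
  then have "a + b = of_int (i * 2 ^ q + j * 2 ^ p) / 2 ^ (p + q)"
    by (simp add: add_frac_eq power_add mult.commute)
  then show ?thesis
    unfolding dyadic_reals_def by blast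
qed

lemma dyadic_reals_uminus: "a \<in> dyadic_reals \<Longrightarrow> - a \<in> dyadic_reals"
  unfolding dyadic_reals_def by clarify (metis minus_divide_left of_int_minus)

lemma dyadic_reals_diff: "\<lbrakk>a \<in> dyadic_reals; b \<in> dyadic_reals\<rbrakk> \<Longrightarrow> a - b \<in> dyadic_reals"
  using dyadic_reals_add[of a "- b"] dyadic_reals_uminus by simp

lemma dyadic_reals_sum: "(\<And>i. i \<in> I \<Longrightarrow> g i \<in> dyadic_reals) \<Longrightarrow> sum g I \<in> dyadic_reals"
proof (induction I rule: infinite_finite_induct)
  case (insert i I)
  then show ?case
    by (simp add: dyadic_reals_add)
qed (use dyadic_reals_of_int[of 0] in simp_all)

lemma countable_dyadic_reals: "countable dyadic_reals"
proof -
  have "dyadic_reals = (\<lambda>(j, q). of_int j / 2 ^ q) ` UNIV"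
    by (auto simp: dyadic_reals_def)
  then show ?thesis
    by (metis countable_image countableI_type)
qed

lemma dyadic_reals_dense:
  assumes "a < b"
  obtains c where "c \<in> dyadic_reals" "a < c" "c < b"
proof -
  obtain q where q: "(1 / 2) ^ q < b - a"
    using real_arch_pow_inv[of "b - a" "1 / 2"] assms by auto
  \<comment> \<open>\<open>j\<close> is the first grid index strictly beyond \<open>a\<close>; the
    mesh \<open>1 / 2 ^ q\<close> is less than \<open>b - a\<close>, so this grid point lies before
    \<open>b\<close>.\<close>
  define j where "j = \<lfloor>a * 2 ^ q\<rfloor> + 1"
  have "a * 2 ^ q < of_int j" "of_int j \<le> a * 2 ^ q + 1"
    unfolding j_def by linarith+
  moreover have "1 < (b - a) * 2 ^ q"
    using q by (simp add: power_divide field_simps)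
  ultimately have "a < of_int j / 2 ^ q" "of_int j / 2 ^ q < b"
    by (simp_all add: field_simps)
  then show ?thesis
    using that[of "of_int j / 2 ^ q"] unfolding dyadic_reals_def by blast
qed

section \<open>Counting representations by a tail\<close>

context pos_series
begin

definition tail_reps :: "nat \<Rightarrow> real \<Rightarrow> nat set set" where
  "tail_reps n t = {A. A \<subseteq> {n..} \<and> infsum x A = t}"

lemma tail_reps_neg: "t < 0 \<Longrightarrow> tail_reps n t = {}"
  using infsum_ge_0 by (auto simp: tail_reps_def simp flip: not_le)

lemma tail_reps_above: "tail n < t \<Longrightarrow> tail_reps n t = {}"
  by (auto simp: tail_reps_def dest!: infsum_le_tail)

lemma tail_reps_0: "tail_reps n 0 = {{}}"
  by (auto simp: tail_reps_def infsum_eq_0)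

lemma tail_reps_tail: "tail_reps n (tail n) = {{n..}}"
  using infsum_eq_subset[of _ "{n..}"] by (auto simp: tail_reps_def tail_def)

lemma infsum_insert_tail:
  assumes "A \<subseteq> {n..}" "i < n"
  shows "infsum x (insert i A) = x i + infsum x A"
proof -
  have "{i} \<inter> A = {}"
    using assms by auto
  then show ?thesis
    using infsum_Un[of "{i}" A] by simp
qed

text \<open>Sort the representations by whether they use \<open>n\<close>. This is the recursion on
  the first binary digit in the count for dyadic points.\<close>

lemma tail_reps_Suc:
  "tail_reps n t = tail_reps (Suc n) t \<union> insert n ` tail_reps (Suc n) (t - x n)" (is "?L = ?R")
proof (intro equalityI subsetI)
  fix A
  assume A: "A \<in> ?L"
  show "A \<in> ?R"
  proof (cases "n \<in> A")
    case False
    then have "A \<subseteq> {Suc n..}"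
      using A by (auto simp: tail_reps_def Suc_le_eq order_less_le)
    then show ?thesis
      using A by (simp add: tail_reps_def)
  next
    case True
    have "A - {n} \<subseteq> {Suc n..}"
      using A by (auto simp: tail_reps_def Suc_le_eq order_less_le)
    then have "A - {n} \<in> tail_reps (Suc n) (t - x n)"
      using A infsum_insert_tail[of "A - {n}" "Suc n" n] True
      by (simp add: tail_reps_def insert_absorb)
    then show ?thesis
      using True by (metis UnI2 image_eqI insert_Diff)
  qed
next
  fix A
  assume "A \<in> ?R"
  then show "A \<in> ?L"
    using infsum_insert_tail[of _ "Suc n" n] by (auto simp: tail_reps_def)
qed

lemma inj_on_insert_tail_reps: "inj_on (insert n) (tail_reps (Suc n) t)"
proof (rule inj_onI)
  fix A B
  assume "A \<in> tail_reps (Suc n) t" "B \<in> tail_reps (Suc n) t" "insert n A = insert n B"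
  moreover from this have "n \<notin> A" "n \<notin> B"
    by (auto simp: tail_reps_def)
  ultimately show "A = B"
    by (metis Diff_insert_absorb)
qed

text \<open>Equality in Kakeya's condition, which amounts to a geometric progression of ratio 1/2
  from \<open>n\<close> on. In this form its failure, together with
  \<open>x k \<le> tail (Suc k)\<close>, gives a strict inequality at once.\<close>

definition binary_from :: "nat \<Rightarrow> bool" where
  "binary_from n \<longleftrightarrow> (\<forall>k\<ge>n. x k = tail (Suc k))"

lemma binary_from_tail:
  assumes "binary_from n"
  shows "tail n = 2 * x n" "tail (Suc n) = x n" "binary_from (Suc n)"
  using assms tail_Suc[of n] by (auto simp: binary_from_def)

lemma binary_from_eq_power:
  assumes "binary_from n" "n \<le> k"
  shows "x k = tail n * (1 / 2 ^ Suc (k - n))"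
  using assms(2)
proof (induction k rule: dec_induct)
  case base
  then show ?case
    using binary_from_tail[OF assms(1)] by simp
next
  case (step k)
  have "binary_from k"
    using assms(1) step.hyps by (simp add: binary_from_def)
  then have "x (Suc k) = x k / 2"
    using binary_from_tail[of k] binary_from_tail[of "Suc k"] by simp
  then show ?case
    using step by (simp add: Suc_diff_le)
qed

text \<open>These are the two binary expansions of a dyadic point. Induction on the exponent
  \<open>q\<close> of the denominator: deciding on the first term passes to
  \<open>tail (Suc n)\<close>, half of \<open>tail n\<close>, and lowers \<open>q\<close> by one; at
  the midpoint the expansions are \<open>{n}\<close> and \<open>{Suc n..}\<close>.\<close>

lemma card_tail_reps_dyadic:
  assumes "binary_from n" "0 < t" "t < tail n" "t / tail n \<in> dyadic_reals"
  shows "card (tail_reps n t) = 2"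
proof -
  obtain j q where "t / tail n = of_int j / 2 ^ q"
    using assms(4) by (auto simp: dyadic_reals_def)
  then show ?thesis
    using assms(1-3)
  proof (induction q arbitrary: n t j)
    case 0
    \<comment> \<open>With denominator 1 an integer would lie strictly between 0 and 1, so this case
      is void.\<close>
    then have "t = of_int j * tail n"
      using tail_pos[of n] by (simp add: field_simps)
    then have "0 < j" "j < 1"
      using "0.prems" tail_pos[of n] by (auto simp: zero_less_mult_iff)
    then show ?case
      by simp
  next
    case (Suc q)
    note b = binary_from_tail[OF \<open>binary_from n\<close>]
    have t: "t / x n = of_int j / 2 ^ q"
      using Suc.prems(1) b pos[of n] by (simp add: field_simps)
    consider "t < x n" | "t = x n" | "t > x n"
      by linarith
    then show ?case
    proof cases
      case 1
      then have "tail_reps n t = tail_reps (Suc n) t"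
        using tail_reps_Suc[of n t] tail_reps_neg[of "t - x n"] by simp
      then show ?thesis
        using Suc.IH[of t "Suc n" j] 1 Suc.prems t b by simp
    next
      case 2
      then have "tail_reps n t = {{Suc n..}, {n}}"
        using tail_reps_Suc[of n t] tail_reps_tail[of "Suc n"] tail_reps_0[of "Suc n"] b by auto
      moreover have "{Suc n..} \<noteq> {n}"
        by (metis atLeast_iff not_less_eq_eq order_refl singletonI)
      ultimately show ?thesis
        by simp
    next
      case 3
      then have "tail_reps n t = insert n ` tail_reps (Suc n) (t - x n)"
        using tail_reps_Suc[of n t] tail_reps_above[of "Suc n" t] b by simp
      then have "card (tail_reps n t) = card (tail_reps (Suc n) (t - x n))"
        by (simp add: card_image inj_on_insert_tail_reps)
      moreover have "(t - x n) / tail (Suc n) = of_int (j - 2 ^ q) / 2 ^ q"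
        using t b pos[of n] by (simp add: field_simps)
      ultimately show ?thesis
        using Suc.IH[of "t - x n" "Suc n" "j - 2 ^ q"] 3 Suc.prems b by simp
    qed
  qed
qed

text \<open>Let \<open>d\<close> be the least index in just one of the sets and \<open>p\<close> the
  common sum below it. The set with \<open>d\<close> has sum at least \<open>p + x d\<close>, the
  other at most \<open>p + tail (Suc d)\<close>, which is the same number. So \<open>t\<close> is a
  finite sum of dyadic multiples of \<open>tail n\<close>.\<close>

lemma two_tail_reps_imp_dyadic:
  assumes b: "binary_from n" and A: "A \<in> tail_reps n t" and B: "B \<in> tail_reps n t" and "A \<noteq> B"
  shows "t / tail n \<in> dyadic_reals"
proof -
  define d where "d = (LEAST d. (d \<in> A) \<noteq> (d \<in> B))"
  have d: "(d \<in> A) \<noteq> (d \<in> B)"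
    unfolding d_def by (rule LeastI_ex) (use \<open>A \<noteq> B\<close> in blast)
  have below: "A \<inter> {..<d} = B \<inter> {..<d}"
    using not_less_Least unfolding d_def by blast
  have "d \<ge> n"
    using d A B by (auto simp: tail_reps_def)
  define p where "p = sum x (A \<inter> {..<d})"
  have upper: "p + x d \<le> t" if "C \<in> {A, B}" "d \<in> C" for C
  proof -
    have "x d \<le> infsum x (C \<inter> {d..})"
      using that by (intro infsum_ge_member) auto
    then show ?thesis
      using infsum_split[of C d] that A B below by (auto simp: p_def tail_reps_def)
  qed
  have lower: "t \<le> p + x d" if "C \<in> {A, B}" "d \<notin> C" for C
  proof -
    have "C \<inter> {d..} \<subseteq> {Suc d..}"
      using that by (auto simp: Suc_le_eq order_less_le)
    then have "infsum x (C \<inter> {d..}) \<le> x d"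
      using infsum_le_tail[of "C \<inter> {d..}" "Suc d"] b \<open>d \<ge> n\<close> by (simp add: binary_from_def)
    then show ?thesis
      using infsum_split[of C d] that A B below by (auto simp: p_def tail_reps_def)
  qed
  have t: "t = p + x d"
    using upper[of A] upper[of B] lower[of A] lower[of B] d by force
  have x: "x k / tail n \<in> dyadic_reals" if "k \<ge> n" for k
    using binary_from_eq_power[OF b that] tail_pos[of n] dyadic_reals_half_power[of "Suc (k - n)"] by simp
  have "p / tail n \<in> dyadic_reals"
    unfolding p_def sum_divide_distrib
    by (rule dyadic_reals_sum, rule x) (use A in \<open>auto simp: tail_reps_def\<close>)
  then show ?thesis
    using x[OF \<open>d \<ge> n\<close>] by (simp add: t add_divide_distrib dyadic_reals_add)
qed

lemma tail_reps_nonempty: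
  assumes "binary_from n" "0 \<le> t" "t \<le> tail n"
  shows "tail_reps n t \<noteq> {}"
proof -
  have "x k \<le> tail (Suc k)" if "k \<ge> n" for k
    using assms(1) that by (simp add: binary_from_def)
  then obtain A where "A \<subseteq> {n..}" "infsum x A = t"
    using greedy_representation assms(2,3) by blast
  then show ?thesis
    by (auto simp: tail_reps_def)
qed

lemma card_tail_reps_not_dyadic:
  assumes "binary_from n" "0 \<le> t" "t \<le> tail n" "t / tail n \<notin> dyadic_reals"
  shows "card (tail_reps n t) = 1"
proof -
  obtain A where "A \<in> tail_reps n t"
    using tail_reps_nonempty assms(1-3) by blast
  then have "tail_reps n t = {A}"
    using two_tail_reps_imp_dyadic assms(1,4) by blast
  then show ?thesis
    by simp
qed

lemma card_tail_reps_cases: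
  assumes "binary_from n" "0 \<le> t" "t \<le> tail n"
  shows "card (tail_reps n t) \<in> {1, 2}"
proof -
  \<comment> \<open>The endpoints have dyadic quotients 0 and 1 but a single representation each, so
    they are kept apart from the interior.\<close>
  consider "t = 0" | "t = tail n" | "0 < t" "t < tail n"
    using assms by linarith
  then show ?thesis
  proof cases
    case 3
    then show ?thesis
      using card_tail_reps_dyadic[OF assms(1)] card_tail_reps_not_dyadic[OF assms] by blast
  qed (simp_all add: tail_reps_0 tail_reps_tail)
qed

text \<open>\<open>card\<close> of an infinite set is 0, so a count of 1 or 2 already shows
  finiteness; outside the interval from 0 to \<open>tail n\<close> there are no
  representations.\<close>

lemma finite_tail_reps: "binary_from n \<Longrightarrow> finite (tail_reps n t)"
  using card_tail_reps_cases[of n t] tail_reps_neg[of t n] tail_reps_above[of n t]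
  by (metis card.infinite finite.emptyI insertE not_le singletonD zero_neq_numeral zero_neq_one)

text \<open>\<open>t\<close> is below \<open>2 * x m\<close> and below every earlier term different
  from \<open>x m\<close>, so a representation uses at most one index up to \<open>m\<close>, and
  its term equals \<open>x m\<close>. Using none gives the first summand, using one gives the
  product.\<close>

lemma card_reps_above_coarsest:
  assumes dec: "decseq x" and b: "binary_from (Suc m)"
    and t: "x m \<le> t" "t < tail (Suc m)"
    and others: "\<And>i. \<lbrakk>i \<le> m; x i \<noteq> x m\<rbrakk> \<Longrightarrow> t < x i"
  shows "card {A. infsum x A = t} =
    card (tail_reps (Suc m) t) + card {i. i \<le> m \<and> x i = x m} * card (tail_reps (Suc m) (t - x m))"
    (is "card ?R = card ?T + card ?K * card ?T'")
proof -
  let ?h = "\<lambda>(i, A). insert i A"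
  have half: "t < 2 * x m"
    \<comment> \<open>\<open>tail (Suc m)\<close> is twice \<open>x (Suc m)\<close>, hence at most
      \<open>2 * x m\<close>; two early indices would overshoot \<open>t\<close>.\<close>
    using t binary_from_tail[OF b] decseqD[OF dec, of m "Suc m"] by simp
  have "?R = ?T \<union> ?h ` (?K \<times> ?T')"
  proof (intro equalityI subsetI)
    fix A
    assume "A \<in> ?R"
    then have A: "infsum x A = t"
      by simp
    show "A \<in> ?T \<union> ?h ` (?K \<times> ?T')"
    proof (cases "A \<subseteq> {Suc m..}")
      case True
      then show ?thesis
        using A by (simp add: tail_reps_def)
    next
      case False
      then obtain i where i: "i \<in> A" "i \<le> m"
        by (metis atLeast_iff not_less_eq_eq subsetI)
      have "x i = x m"
        using others[of i] infsum_ge_member[OF i(1)] A i(2) by force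
      have "A - {i} \<subseteq> {Suc m..}"
      proof
        fix k
        assume k: "k \<in> A - {i}"
        show "k \<in> {Suc m..}"
        proof (rule ccontr)
          assume "k \<notin> {Suc m..}"
          then have "x k \<ge> x m"
            using decseqD[OF dec, of k m] by simp
          moreover have "infsum x {i, k} \<le> t"
            using infsum_subset_le[of "{i, k}" A] i k A by simp
          ultimately show False
            using half k \<open>x i = x m\<close> by simp
        qed
      qed
      then have "A - {i} \<in> ?T'"
        using infsum_insert_tail[of "A - {i}" "Suc m" i] i A \<open>x i = x m\<close>
        by (simp add: tail_reps_def insert_absorb)
      then show ?thesis
        using i \<open>x i = x m\<close> by (intro UnI2 image_eqI[of _ _ "(i, A - {i})"]) auto
    qed
  next
    fix A
    assume "A \<in> ?T \<union> ?h ` (?K \<times> ?T')"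
    then show "A \<in> ?R"
      using infsum_insert_tail[of _ "Suc m"] by (auto simp: tail_reps_def)
  qed
  moreover have "?T \<inter> ?h ` (?K \<times> ?T') = {}"
    by (force simp: tail_reps_def)
  moreover have "inj_on ?h (?K \<times> ?T')"
  proof (rule inj_onI)
    fix p q
    assume pq: "p \<in> ?K \<times> ?T'" "q \<in> ?K \<times> ?T'" "?h p = ?h q"
    \<comment> \<open>Cutting the union at \<open>m\<close> recovers both the early index and the
      late set.\<close>
    have "{fst p} = ?h p \<inter> {..m}" "snd p = ?h p \<inter> {Suc m..}" if "p \<in> ?K \<times> ?T'" for p
      using that by (force simp: tail_reps_def)+
    from this[OF pq(1)] this[OF pq(2)] pq(3) show "p = q"
      by (metis prod_eqI singleton_inject)
  qed
  moreover have "finite (?K \<times> ?T')" "finite ?T"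
    using finite_tail_reps[OF b] by (auto intro: finite_subset[of ?K "{..m}"])
  ultimately show ?thesis
    by (simp add: card_Un_disjoint card_image card_cartesian_product)
qed

text \<open>In units of \<open>L\<close>, the tail represents each dyadic point strictly between 0
  and 1 twice and each other point there once. Choosing whether \<open>\<tau>\<close> and
  \<open>\<tau> - \<alpha>\<close> are dyadic, according to \<open>card K\<close>, steers the
  count.\<close>

lemma representations_3_or_7:
  assumes dec: "decseq x" and b: "binary_from (Suc m)" and less: "x m < tail (Suc m)"
  obtains t where "card {A. infsum x A = t} = 3 \<or> card {A. infsum x A = t} \<ge> 7"
proof -
  define L where "L = tail (Suc m)"
  define K where "K = {i. i \<le> m \<and> x i = x m}"
  define \<alpha> where "\<alpha> = x m / L"
  have L: "L > 0"
    using tail_pos by (simp add: L_def)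
  \<comment> \<open>The count formula holds up to \<open>\<beta>\<close>: the smallest earlier term
    above \<open>x m\<close>, or \<open>L\<close> if that is less. Inserting \<open>L\<close> keeps
    the set nonempty and gives \<open>\<beta> \<le> 1\<close>.\<close>
  define \<beta> where "\<beta> = Min (insert L (x ` ({..m} - K))) / L"
  have x_gt: "x m < x i" if "i \<in> {..m} - K" for i
    using that decseqD[OF dec, of i m] by (auto simp: K_def order_less_le)
  have \<alpha>: "0 < \<alpha>" "\<alpha> < 1" "x m = \<alpha> * L"
    using L less pos[of m] by (simp_all add: \<alpha>_def L_def)
  have "\<alpha> < \<beta>"
    using x_gt less L unfolding \<alpha>_def \<beta>_def
    by (intro divide_strict_right_mono) (auto simp: L_def)
  have "\<beta> \<le> 1"
    using L by (simp add: \<beta>_def)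
  have count: "card {A. infsum x A = \<tau> * L} =
      card (tail_reps (Suc m) (\<tau> * L)) + card K * card (tail_reps (Suc m) ((\<tau> - \<alpha>) * L))"
    if "\<alpha> \<le> \<tau>" "\<tau> < \<beta>" for \<tau>
  proof -
    have \<tau>: "\<tau> * L < Min (insert L (x ` ({..m} - K)))"
      using that(2) L by (simp add: \<beta>_def field_simps)
    have "x m \<le> \<tau> * L"
      using that(1) \<alpha>(3) L by simp
    then have "card {A. infsum x A = \<tau> * L} = card (tail_reps (Suc m) (\<tau> * L))
        + card K * card (tail_reps (Suc m) (\<tau> * L - x m))"
      unfolding K_def using \<tau>
      by (intro card_reps_above_coarsest[OF dec b]) (auto simp: K_def L_def)
    then show ?thesis
      by (simp add: \<alpha>(3) algebra_simps)
  qed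
  have dy: "card (tail_reps (Suc m) (\<tau> * L)) = 2" if "0 < \<tau>" "\<tau> < 1" "\<tau> \<in> dyadic_reals" for \<tau>
    using that L card_tail_reps_dyadic[OF b, of "\<tau> * L"] by (simp add: L_def)
  have ndy: "card (tail_reps (Suc m) (\<tau> * L)) = 1" if "0 < \<tau>" "\<tau> < 1" "\<tau> \<notin> dyadic_reals" for \<tau>
    using that L card_tail_reps_not_dyadic[OF b, of "\<tau> * L"] by (simp add: L_def)
  have "K \<noteq> {}" "finite K"
    by (auto simp: K_def)
  then have "card K \<noteq> 0"
    by simp
  then consider "card K = 1" "\<alpha> \<in> dyadic_reals" | "card K = 1" "\<alpha> \<notin> dyadic_reals" | "card K = 2" | "card K \<ge> 3"
    by linarith
  then show ?thesis
  proof cases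
    case 1
    \<comment> \<open>Count 2 + 1: \<open>\<alpha>\<close> is dyadic, and the remainder 0 has only
      the empty representation.\<close>
    then have "card {A. infsum x A = \<alpha> * L} = 3"
      using count[of \<alpha>] dy[of \<alpha>] \<alpha> \<open>\<alpha> < \<beta>\<close> by (simp add: tail_reps_0)
    then show ?thesis
      using that by blast
  next
    case 2
    \<comment> \<open>A dyadic \<open>\<tau>\<close> leaves a remainder that is not dyadic: again 2
      + 1.\<close>
    obtain \<tau> where \<tau>: "\<tau> \<in> dyadic_reals" "\<alpha> < \<tau>" "\<tau> < \<beta>"
      using dyadic_reals_dense \<open>\<alpha> < \<beta>\<close> by blast
    moreover have "\<tau> - \<alpha> \<notin> dyadic_reals"
      using dyadic_reals_diff[OF \<tau>(1), of "\<tau> - \<alpha>"] 2 by auto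
    ultimately have "card {A. infsum x A = \<tau> * L} = 3"
      using 2 count[of \<tau>] dy[of \<tau>] ndy[of "\<tau> - \<alpha>"] \<alpha> \<open>\<beta> \<le> 1\<close> by simp
    then show ?thesis
      using that by blast
  next
    case 3
    \<comment> \<open>Avoiding a countable set makes both \<open>\<tau>\<close> and
      \<open>\<tau> - \<alpha>\<close> non-dyadic, for the count 1 + 2 * 1.\<close>
    have "uncountable ({\<alpha><..<\<beta>} - (dyadic_reals \<union> (+) \<alpha> ` dyadic_reals))"
      using \<open>\<alpha> < \<beta>\<close>
      by (intro uncountable_minus_countable) (simp_all add: uncountable_open_interval countable_dyadic_reals)
    then obtain \<tau> where \<tau>: "\<alpha> < \<tau>" "\<tau> < \<beta>" "\<tau> \<notin> dyadic_reals" "\<tau> \<notin> (+) \<alpha> ` dyadic_reals"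
      by (metis DiffE UnI1 UnI2 countable_empty equals0I greaterThanLessThan_iff)
    then have "\<tau> - \<alpha> \<notin> dyadic_reals"
      by force
    then have "card {A. infsum x A = \<tau> * L} = 3"
      using 3 \<tau> count[of \<tau>] ndy[of \<tau>] ndy[of "\<tau> - \<alpha>"] \<alpha> \<open>\<beta> \<le> 1\<close> by simp
    then show ?thesis
      using that by blast
  next
    case 4
    \<comment> \<open>With a dyadic remainder \<open>\<delta>\<close> each of the at least three
      indices in \<open>K\<close> contributes 2, and the tail alone at least 1: together at least
      7.\<close>
    obtain \<delta> where \<delta>: "\<delta> \<in> dyadic_reals" "0 < \<delta>" "\<delta> < \<beta> - \<alpha>"
      using dyadic_reals_dense[of 0 "\<beta> - \<alpha>"] \<open>\<alpha> < \<beta>\<close> by auto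
    have "card (tail_reps (Suc m) ((\<alpha> + \<delta>) * L)) \<ge> 1"
      using dy[of "\<alpha> + \<delta>"] ndy[of "\<alpha> + \<delta>"] \<delta> \<alpha> \<open>\<beta> \<le> 1\<close> by fastforce
    moreover have "card {A. infsum x A = (\<alpha> + \<delta>) * L} =
        card (tail_reps (Suc m) ((\<alpha> + \<delta>) * L)) + card K * 2"
      using count[of "\<alpha> + \<delta>"] dy[of \<delta>] \<delta> \<alpha> \<open>\<beta> \<le> 1\<close> by simp
    ultimately have "card {A. infsum x A = (\<alpha> + \<delta>) * L} \<ge> 7"
      using 4 by linarith
    then show ?thesis
      using that by blast
  qed
qed

section \<open>Counts when the subset sums fill an interval\<close>

lemma card_reps_range:
  assumes "binary_from 0"
  shows "(\<lambda>t. card {A. infsum x A = t}) ` {0..tail 0} = {1, 2}"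
proof -
  have eq: "{A. infsum x A = t} = tail_reps 0 t" for t
    by (auto simp: tail_reps_def)
  have "card (tail_reps 0 (tail 0 / 2)) = 2"
    using tail_pos[of 0] dyadic_reals_half_power[of 1]
    by (intro card_tail_reps_dyadic[OF assms]) simp_all
  moreover have "card (tail_reps 0 0) = 1"
    by (simp add: tail_reps_0)
  ultimately have "{1, 2} \<subseteq> (\<lambda>t. card (tail_reps 0 t)) ` {0..tail 0}"
    using tail_pos[of 0] by (force intro: rev_image_eqI)
  then show ?thesis
    unfolding eq using card_tail_reps_cases[OF assms] by fastforce
qed

text \<open>Necessary half of Kakeya's theorem: otherwise there is a gap between
  \<open>tail (Suc n)\<close> and \<open>x n\<close>. Its midpoint is too large for sets of later
  indices and, as the terms decrease, too small for any set with an index up to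
  \<open>n\<close>.\<close>

lemma le_tail_Suc_if_interval:
  assumes dec: "decseq x" and "\<And>t. \<lbrakk>0 \<le> t; t \<le> tail 0\<rbrakk> \<Longrightarrow> \<exists>A. infsum x A = t"
  shows "x n \<le> tail (Suc n)"
proof (rule ccontr)
  assume "\<not> x n \<le> tail (Suc n)"
  moreover define t where "t = (x n + tail (Suc n)) / 2"
  ultimately have t: "tail (Suc n) < t" "t < x n"
    by simp_all
  moreover have "x n \<le> tail 0"
    by (simp add: tail_0 infsum_ge_member)
  ultimately obtain A where A: "infsum x A = t"
    using assms(2)[of t] tail_pos[of "Suc n"] by auto
  show False
  proof (cases "A \<subseteq> {Suc n..}")
    case True
    then show ?thesis
      using infsum_le_tail[OF True] A t by simp
  next
    case False
    then obtain i where "i \<in> A" "i \<le> n"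
      by (metis atLeast_iff not_less_eq_eq subsetI)
    then have "x n \<le> t"
      using decseqD[OF dec, of i n] infsum_ge_member[of i A] A by simp
    then show ?thesis
      using t by simp
  qed
qed

text \<open>If strict inequality recurred forever, \<open>many_representations\<close> would give a
  point with \<open>Suc N\<close> representations.\<close>

lemma eventually_binary:
  assumes fill: "\<And>k. x k \<le> tail (Suc k)"
    and bound: "\<And>t. finite {A. infsum x A = t} \<and> card {A. infsum x A = t} \<le> N"
  shows "\<exists>n. binary_from n"
proof (rule ccontr)
  assume "\<nexists>n. binary_from n"
  then have slack: "\<exists>k\<ge>n. x k < tail (Suc k)" for n
    using fill unfolding binary_from_def by (metis order_less_le)
  obtain u v where uv: "u < v" and
    E: "\<And>t. \<lbrakk>u < t; t < v\<rbrakk> \<Longrightarrow>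
      \<exists>E. finite E \<and> card E = Suc N \<and> (\<forall>A\<in>E. A \<subseteq> {0..} \<and> infsum x A = t)"
    by (rule many_representations[of 0 "tail 0" 0 "Suc N"]) (use fill slack tail_pos[of 0] in auto)
  obtain E where "card E = Suc N" "E \<subseteq> {A. infsum x A = (u + v) / 2}"
    using E[of "(u + v) / 2"] uv by auto
  then show False
    using card_mono[of "{A. infsum x A = (u + v) / 2}" E] bound[of "(u + v) / 2"] by simp
qed

lemma representation_counts:
  assumes "decseq x" and "\<And>t. \<lbrakk>0 \<le> t; t \<le> tail 0\<rbrakk> \<Longrightarrow> \<exists>A. infsum x A = t"
    and "\<And>t. finite {A. infsum x A = t} \<and> card {A. infsum x A = t} \<le> N"
  shows "(\<lambda>t. card {A. infsum x A = t}) ` {0..tail 0} = {1, 2} \<or>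
    (\<exists>t. card {A. infsum x A = t} = 3 \<or> card {A. infsum x A = t} \<ge> 7)"
proof -
  have fill: "x k \<le> tail (Suc k)" for k
    using assms(1,2) by (rule le_tail_Suc_if_interval)
  define n where "n = (LEAST n. binary_from n)"
  have n: "binary_from n"
    unfolding n_def using eventually_binary[OF fill assms(3)] by (rule LeastI_ex)
  show ?thesis
  proof (cases n)
    case 0
    then show ?thesis
      using card_reps_range n by blast
  next
    case (Suc m)
    then have "\<not> binary_from m"
      using not_less_Least[of m binary_from] by (simp add: n_def)
    \<comment> \<open>All later equalities hold, so by minimality of \<open>n\<close> the failure is
      at \<open>m\<close> itself.\<close>
    then have "x m \<noteq> tail (Suc m)"
      using n unfolding Suc binary_from_def by (metis Suc_leI order_less_le)
    then have "x m < tail (Suc m)"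
      using fill[of m] by simp
    then show ?thesis
      using representations_3_or_7[OF assms(1)] n Suc by blast
  qed
qed

end

section \<open>Transfer from the decreasing rearrangement to the given sequence\<close>

theorem theorem7p4:
  assumes "M \<in> I1" and "bounded_cv M" and "M \<noteq> {Fin 1, Fin 2}" and "Fin 3 \<notin> M"
  shows "Max {k. Fin k \<in> M} \<ge> 7"
proof -
  obtain y a b where "\<forall>n. y n > 0" and y_summable: "summable y"
    and ab: "achievement_set y = {a..b}" and M: "M = cardinal_function y ` achievement_set y"
    using assms(1) unfolding I1_def by blast
  then have y_pos: "y n > 0" for n
    by simp
  note y = y_pos y_summable
  obtain N where N: "M \<subseteq> Fin ` {1..N}"
    using assms(2) by (auto simp: bounded_cv_def)
  have y_on: "y summable_on UNIV"
    using y by (intro summable_nonneg_imp_summable_on) (auto simp: less_imp_le)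
  \<comment> \<open>Reordering the terms only relabels the representations, so the achievement set
    and all counts are preserved.\<close>
  obtain \<pi> :: "nat \<Rightarrow> nat" where \<pi>: "bij \<pi>" "decseq (y \<circ> \<pi>)"
    using decreasing_rearrangement[of y] y summable_LIMSEQ_zero by blast
  define x where "x = y \<circ> \<pi>"
  interpret pos_series x
  proof
    show "x n > 0" for n
      by (simp add: x_def y_pos)
    show "x summable_on UNIV"
      using summable_on_reindex_bij_betw[OF \<pi>(1), of y] y_on by (simp add: x_def o_def)
  qed
  have sum_eq: "infsum x A = infsum y (\<pi> ` A)" for A
    unfolding x_def using infsum_reindex[OF inj_on_subset[OF bij_is_inj[OF \<pi>(1)] subset_UNIV]] by metis
  have range: "achievement_set y = range (infsum x)"
  proof -
    have "achievement_set y = range (infsum y)"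
      by (auto simp: achievement_set_def suminf_if_eq_infsum[OF y])
    also have "\<dots> = range (infsum x)"
    proof (intro equalityI subsetI)
      fix s
      assume "s \<in> range (infsum y)"
      then obtain B where "s = infsum y B"
        by blast
      then have "s = infsum x (\<pi> -` B)"
        using sum_eq[of "\<pi> -` B"] \<pi>(1) by (simp only: bij_def surj_image_vimage_eq)
      then show "s \<in> range (infsum x)"
        by blast
    next
      fix s
      assume "s \<in> range (infsum x)"
      then show "s \<in> range (infsum y)"
        by (auto simp: sum_eq)
    qed
    finally show ?thesis .
  qed
  \<comment> \<open>The empty sum and the full sum are attained and bound all others, so they are
    the endpoints of the interval.\<close>
  have "0 \<in> {a..b}" "tail 0 \<in> {a..b}"
    using ab range rangeI[of "infsum x" "{}"] rangeI[of "infsum x" UNIV] by (simp_all add: tail_0)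
  then have "{0..tail 0} \<subseteq> range (infsum x)"
    using ab range by auto
  moreover have "range (infsum x) \<subseteq> {0..tail 0}"
    using infsum_ge_0 by (auto simp: tail_0 infsum_subset_le)
  ultimately have ach: "achievement_set y = {0..tail 0}" "range (infsum x) = {0..tail 0}"
    using range by simp_all
  have card_eq: "cardinal_function y t = cardval_of {A. infsum x A = t}" for t
  proof -
    \<comment> \<open>A set of positions in the rearranged sequence corresponds to the indicator of
      its image under \<open>\<pi>\<close>.\<close>
    have "bij_betw (\<lambda>A n. n \<in> \<pi> ` A) {A. infsum x A = t} (reps y t)"
    proof (rule bij_betw_byWitness[where f' = "\<lambda>e. {n. e (\<pi> n)}"])
      show "\<forall>A\<in>{A. infsum x A = t}. {n. \<pi> n \<in> \<pi> ` A} = A"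
        using \<pi>(1) by (auto simp: bij_def inj_image_mem_iff)
      have img: "\<pi> ` {n. e (\<pi> n)} = Collect e" for e
        using \<pi>(1) surj_image_vimage_eq[of \<pi> "Collect e"] by (simp add: bij_def vimage_def)
      then show "\<forall>e\<in>reps y t. (\<lambda>n. n \<in> \<pi> ` {n. e (\<pi> n)}) = e"
        by simp
      show "(\<lambda>A n. n \<in> \<pi> ` A) ` {A. infsum x A = t} \<subseteq> reps y t"
        using suminf_if_eq_infsum[OF y] by (auto simp: reps_def sum_eq)
      show "(\<lambda>e. {n. e (\<pi> n)}) ` reps y t \<subseteq> {A. infsum x A = t}"
        using suminf_if_eq_infsum[OF y, of "Collect _"] by (auto simp: reps_def sum_eq img)
    qed
    then show ?thesis
      by (simp add: cardinal_function_def cardval_of_bij_betw)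
  qed
  \<comment> \<open>Boundedness of \<open>M\<close> excludes \<open>Omega\<close> and
    \<open>Cont\<close> on the achievement set; elsewhere there is nothing to count.\<close>
  have fin: "finite {A. infsum x A = t} \<and> card {A. infsum x A = t} \<le> N" for t
  proof (cases "t \<in> {0..tail 0}")
    case True
    then have "cardval_of {A. infsum x A = t} \<in> Fin ` {1..N}"
      using N M ach card_eq by (metis image_eqI subsetD)
    then show ?thesis
      by (auto simp: cardval_of_def split: if_splits)
  next
    case False
    then have "{A. infsum x A = t} = {}"
      using ach by blast
    then show ?thesis
      by simp
  qed
  then have M': "M = Fin ` (\<lambda>t. card {A. infsum x A = t}) ` {0..tail 0}"
    by (simp add: M ach card_eq cardval_of_def image_image)
  \<comment> \<open>A positive count places \<open>t\<close> in the achievement set; this covers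
    both 3 and values from 7 on.\<close>
  have in_M: "Fin (card {A. infsum x A = t}) \<in> M" if count: "card {A. infsum x A = t} > 0" for t
  proof -
    obtain A where "infsum x A = t"
      using count by (auto simp: card_gt_0_iff)
    then have "t \<in> {0..tail 0}"
      using ach by blast
    then show ?thesis
      by (simp add: M')
  qed
  have "\<exists>A. infsum x A = t" if "0 \<le> t" "t \<le> tail 0" for t
    using ach that by (metis atLeastAtMost_iff rangeE)
  then have "(\<lambda>t. card {A. infsum x A = t}) ` {0..tail 0} = {1, 2} \<or>
      (\<exists>t. card {A. infsum x A = t} = 3 \<or> card {A. infsum x A = t} \<ge> 7)"
    using representation_counts[of N] \<pi>(2) fin x_def by blast
  then obtain t where "card {A. infsum x A = t} = 3 \<or> card {A. infsum x A = t} \<ge> 7"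
    using M' assms(3) by auto
  then have "card {A. infsum x A = t} \<ge> 7" "Fin (card {A. infsum x A = t}) \<in> M"
    using in_M[of t] assms(4) by auto
  \<comment> \<open>\<open>Max\<close> is known to dominate the members only of a finite set; the
    bound \<open>N\<close> supplies finiteness.\<close>
  moreover have "finite {k. Fin k \<in> M}"
    by (rule finite_subset[of _ "{1..N}"]) (use N in auto)
  ultimately show ?thesis
    using order.trans[OF _ Max_ge] by blast
qed

end
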